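(* Let $n\geq 2$ be an integer. Then $$ c_n\geq \frac{1}{1+\frac{(-1)^n-5}{10n}+\frac{\varphi^{2n}+\varphi^{-2n}}{5n}+\frac{n-1}{5n}\sqrt{R_n}}, $$ where $$ R_n=\frac{4(-1)^n}{n-1}+\frac{2\sqrt 5\, n^2(\varphi^{2n}-\varphi^{-2n})}{n-1}+\frac{3(-1)^n+17}{2}+\Big((-1)^n-7-\frac{2}{n-1}\Big)(\varphi^{2n}+\varphi^{-2n})+\varphi^{4n}+\varphi^{-4n}. $$
   Context: For a positive integer $n$, let $K_n$ denote the (finite) set of all nonsingular lower triangular $n\times n$ matrices with all entries in $\{0,1\}$ (regarded as real matrices). Hong and Loewy's numbers are defined by $$ c_n=\min\{\lambda\mid \lambda\text{ is an eigenvalue of }XX^{\rm T},\ X\in K_n\},\quad n\in\mathbb Z_+ . $$ The golden ratio is denoted by $\varphi=\frac{1+\sqrt 5}{2}$. *)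

theory Defs
  imports "Jordan_Normal_Form.Char_Poly" Complex_Main
begin

definition lower_triangular :: "'a::zero mat \<Rightarrow> bool" where
  "lower_triangular A \<longleftrightarrow> (\<forall>i < dim_row A. \<forall>j < dim_col A. i < j \<longrightarrow> A $$ (i, j) = 0)"

definition K :: "nat \<Rightarrow> real mat set" where
  "K n = {X \<in> carrier_mat n n. invertible_mat X \<and> lower_triangular X \<and> elements_mat X \<subseteq> {0, 1}}"

(* For n > 0 this is the minimum of a finite nonempty set of reals.  All eigenvalues
   of the symmetric real matrix X * X\<^sup>T are real, so considering real
   eigenvalues only loses nothing. *)
definition c :: "nat \<Rightarrow> real" where
  "c n = Min {l. \<exists>X \<in> K n. eigenvalue (X * transpose_mat X) l}"

definition \<phi> :: real where
  "\<phi> = (1 + sqrt 5) / 2"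

definition R :: "nat \<Rightarrow> real" where
  "R n = 4 * (-1) ^ n / (real n - 1)
       + 2 * sqrt 5 * (real n)\<^sup>2 * (\<phi> powi (2 * int n) - \<phi> powi (- 2 * int n)) / (real n - 1)
       + (3 * (-1) ^ n + 17) / 2
       + ((-1) ^ n - 7 - 2 / (real n - 1)) * (\<phi> powi (2 * int n) + \<phi> powi (- 2 * int n))
       + \<phi> powi (4 * int n) + \<phi> powi (- 4 * int n)"

end

theory Submission
  imports Defs "HOL-Number_Theory.Fib" "HOL-Analysis.Convex" "Jordan_Normal_Form.Spectral_Radius"
begin

text \<open>
  If \<open>X X\<^sup>T v = l v\<close> and \<open>w = X\<^sup>T v\<close>, then \<open>|w|\<^sup>2 = l |v|\<^sup>2\<close> while \<open>v = (X\<^sup>-\<^sup>1)\<^sup>T w\<close>, so a lower bound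
  on \<open>l\<close> is the same thing as an upper bound on the norm of \<open>(X\<^sup>-\<^sup>1)\<^sup>T w\<close> relative to \<open>w\<close>.  Forward
  substitution with coefficients in \<open>{0, 1}\<close> cannot grow faster than the Fibonacci numbers
  (\<open>forward_substitution_fib_bound\<close>), so the entries of \<open>X\<^sup>-\<^sup>1\<close> are dominated, uniformly in
  \<open>X \<in> K n\<close>, by those of the lower triangular Toeplitz matrix \<open>B\<close> with first column
  \<open>1, F\<^sub>1, F\<^sub>2, F\<^sub>3, \<dots>\<close>.  Hence \<open>1 / l\<close> is at most the largest value of the quadratic form of
  \<open>G = B B\<^sup>T\<close> on the unit sphere (\<open>eigenvalue_ge_if_gram_form_le\<close>).

  That value is bounded from the trace \<open>T\<close> and the squared Frobenius norm \<open>Q\<close> of \<open>G\<close> alone: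
  the Cauchy--Schwarz inequality for the traceless parts of \<open>G\<close> and of \<open>u u\<^sup>T\<close> gives the
  Wolkowicz--Styan bound \<open>T/n + sqrt ((1 - 1/n) (Q - T\<^sup>2/n))\<close>
  (\<open>quadratic_form_le_trace_frobenius\<close>).

  The rest is exact evaluation.  The entries of \<open>G\<close> are products of two Fibonacci numbers, up to
  the summand 1 on the diagonal, and \<open>T\<close> and \<open>Q\<close> have closed forms in \<open>F\<^sub>n\<close>, \<open>F\<^sub>n\<^sub>+\<^sub>1\<close> and \<open>(-1)\<^sup>n\<close>.
  Rewritten by Binet's formula in powers of the golden ratio they satisfy
  \<open>(n - 1) R\<^sub>n = 25 (n Q - T\<^sup>2)\<close>, which turns the bound above into the denominator of the theorem
  (\<open>trace_frobenius_bound_gram\<close>).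
\<close>

section \<open>The Gram matrix of the Fibonacci Toeplitz matrix\<close>

text \<open>
  First column of the dominating matrix \<open>B\<close>, with \<open>B\<^sub>i\<^sub>k = fib_coeff (i - k)\<close> for \<open>k \<le> i\<close>.  It differs
  from the Fibonacci sequence only at 0, because the diagonal of \<open>B\<close> is 1.
\<close>
definition fib_coeff :: "nat \<Rightarrow> real" where
  "fib_coeff k = (if k = 0 then 1 else real (fib k))"

text \<open>
  The entries of \<open>B B\<^sup>T\<close>.  Working with \<open>B B\<^sup>T\<close> rather than \<open>B\<^sup>T B\<close> makes them independent of the
  size \<open>n\<close>, so that the trace and the Frobenius norm can be computed by induction on \<open>n\<close>.
\<close>
definition gram :: "nat \<Rightarrow> nat \<Rightarrow> real" where
  "gram i j = (\<Sum>k\<le>min i j. fib_coeff (i - k) * fib_coeff (j - k))"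

lemma gram_sym: "gram i j = gram j i"
  by (simp add: gram_def min.commute mult.commute)

lemma fib_Cassini_real:
  "(real (fib (Suc n)))\<^sup>2 - real (fib n) * real (fib (Suc n)) - (real (fib n))\<^sup>2 = (-1) ^ n"
proof (induction n)
  case (Suc n)
  then show ?case by (simp add: power2_eq_square algebra_simps)
qed simp

lemma gram_shift: "gram i (i + d) = (\<Sum>k\<le>i. fib_coeff k * fib_coeff (k + d))"
  unfolding gram_def
  by (rule sum.reindex_bij_witness[of _ "\<lambda>k. i - k" "\<lambda>k. i - k"]) auto

lemma gram_diag: "gram i i = 1 + real (fib i) * real (fib (Suc i))"
proof -
  have "(\<Sum>k\<le>i. fib_coeff k * fib_coeff (k + 0)) = 1 + real (fib i) * real (fib (Suc i))"
    by (induction i) (simp_all add: fib_coeff_def algebra_simps)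
  with gram_shift[of i 0] show ?thesis by simp
qed

text \<open>
  Along a fixed diagonal, passing from \<open>i\<close> to \<open>i + 1\<close> adds \<open>F\<^sub>i\<^sub>+\<^sub>1 F\<^sub>j\<^sub>+\<^sub>1\<close>, which raises the index
  of only one of the two factors by two; which factor this is alternates with the parity of \<open>i\<close>.
\<close>
lemma gram_above_diag:
  assumes "i < j"
  shows "gram i j = (if odd i then real (fib i) * real (fib (Suc j))
                              else real (fib (Suc i)) * real (fib j))"
proof -
  obtain d where j: "j = i + Suc d"
    using assms less_iff_Suc_add by auto
  have "(\<Sum>k\<le>i. fib_coeff k * fib_coeff (k + Suc d)) =
      (if odd i then real (fib i) * real (fib (Suc (i + Suc d)))
                else real (fib (Suc i)) * real (fib (i + Suc d)))"
    by (induction i) (auto simp: fib_coeff_def algebra_simps)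
  with gram_shift[of i "Suc d"] j show ?thesis by simp
qed

lemma trace_gram:
  "(\<Sum>i<n. gram i i) = real n + (real (fib n))\<^sup>2 + ((-1) ^ n - 1) / 2"
proof (induction n)
  case (Suc n)
  show ?case
    unfolding sum.lessThan_Suc Suc.IH
    unfolding gram_diag power_Suc of_nat_Suc fib_Cassini_real[of n, symmetric]
    by (simp add: field_simps)
qed simp

text \<open>
  The product on the right is \<open>F\<^sub>4\<^sub>m\<close>, written with \<open>F\<^sub>2\<^sub>m\<close> and \<open>F\<^sub>2\<^sub>m\<^sub>+\<^sub>1\<close>; the linear term is where
  the factor \<open>n\<close> in the Frobenius norm comes from.
\<close>
lemma sum_odd_fib_squares:
  "5 * (\<Sum>k<m. (real (fib (2 * k + 1)))\<^sup>2) =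
     real (fib (2 * m)) * (2 * real (fib (2 * m + 1)) - real (fib (2 * m))) + 2 * real m"
proof (induction m)
  case (Suc m)
  define x where "x = real (fib (2 * m))"
  define y where "y = real (fib (2 * m + 1))"
  have fibs: "real (fib (2 * Suc m)) = x + y" "real (fib (2 * Suc m + 1)) = x + 2 * y"
    by (simp_all add: x_def y_def)
  have "(x + y) * (2 * (x + 2 * y) - (x + y)) - x * (2 * y - x) - 5 * y\<^sup>2 + 2
      = - 2 * (y\<^sup>2 - x * y - x\<^sup>2 - 1)"
    by (simp add: algebra_simps power2_eq_square)
  also have "y\<^sup>2 - x * y - x\<^sup>2 - 1 = 0"
    using fib_Cassini_real[of "2 * m"] by (simp add: x_def y_def)
  finally show ?case
    unfolding fibs sum.lessThan_Suc of_nat_Suc distrib_left Suc.IH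
    unfolding x_def y_def by linarith
qed simp

text \<open>
  Above the diagonal, the rows \<open>2 k\<close> and \<open>2 k + 1\<close> share the factor \<open>F\<^sub>2\<^sub>k\<^sub>+\<^sub>1\<close> and have the remaining
  factors \<open>F\<^sub>j\<close> and \<open>F\<^sub>j\<^sub>+\<^sub>1\<close>, so a column is summed two rows at a time.
\<close>
lemma sum_gram_column_pairs:
  assumes "2 * m \<le> j"
  shows "(\<Sum>i<2 * m. (gram i j)\<^sup>2) =
    ((real (fib j))\<^sup>2 + (real (fib (Suc j)))\<^sup>2) * (\<Sum>k<m. (real (fib (2 * k + 1)))\<^sup>2)"
  using assms
proof (induction m)
  case (Suc m)
  have "gram (2 * m) j = real (fib (2 * m + 1)) * real (fib j)"
    using Suc.prems by (subst gram_above_diag) auto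
  moreover have "gram (2 * m + 1) j = real (fib (2 * m + 1)) * real (fib (Suc j))"
    using Suc.prems by (subst gram_above_diag) auto
  ultimately show ?case using Suc by (simp add: algebra_simps power_mult_distrib)
qed simp

lemma sum_square_Suc_sym:
  fixes g :: "nat \<Rightarrow> nat \<Rightarrow> real"
  assumes "\<And>i j. g i j = g j i"
  shows "(\<Sum>i<Suc n. \<Sum>j<Suc n. g i j) = (\<Sum>i<n. \<Sum>j<n. g i j) + 2 * (\<Sum>i<n. g i n) + g n n"
proof -
  have "(\<Sum>j<n. g n j) = (\<Sum>i<n. g i n)"
    by (rule sum.cong[OF refl assms])
  then show ?thesis by (simp add: sum.distrib)
qed

text \<open>
  Enlarging the matrix by one row and column adds twice a column sum and a diagonal square.  With
  \<open>x = F\<^sub>n\<close> and \<open>y = F\<^sub>n\<^sub>+\<^sub>1\<close> the induction step is then a polynomial identity modulo Cassini's relation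
  \<open>y\<^sup>2 - x y - x\<^sup>2 = (-1)\<^sup>n\<close>, one for each parity of \<open>n\<close>.  In the closed form, \<open>5 x\<^sup>2 + 2 s\<close> is the
  Lucas number \<open>L\<^sub>2\<^sub>n\<close> and \<open>x (2 y - x)\<close> is \<open>F\<^sub>2\<^sub>n\<close>.
\<close>
lemma frobenius_norm_gram:
  fixes n :: nat
  defines "s \<equiv> (-1) ^ n" and "x \<equiv> real (fib n)" and "y \<equiv> real (fib (Suc n))"
  shows "25 * (\<Sum>i<n. \<Sum>j<n. (gram i j)\<^sup>2) =
    (5 * x\<^sup>2 + 2 * s)\<^sup>2 + (s + 3) * (5 * x\<^sup>2 + 2 * s) + (13 * s - 37) / 2
      + 25 * real n + 10 * real n * (x * (2 * y - x))"
  unfolding s_def x_def y_def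
proof (induction n)
  case (Suc n)
  define F where "F s x y m = (5 * x\<^sup>2 + 2 * s)\<^sup>2 + (s + 3) * (5 * x\<^sup>2 + 2 * s) + (13 * s - 37) / 2
      + 25 * m + 10 * m * (x * (2 * y - x))" for s x y m :: real
  define x where "x = real (fib n)"
  define y where "y = real (fib (Suc n))"
  have z: "real (fib (Suc (Suc n))) = x + y" by (simp add: x_def y_def)
  have t: "(\<Sum>i<Suc n. \<Sum>j<Suc n. (gram i j)\<^sup>2) =
    (\<Sum>i<n. \<Sum>j<n. (gram i j)\<^sup>2) + 2 * (\<Sum>i<n. (gram i n)\<^sup>2) + (gram n n)\<^sup>2"
    by (rule sum_square_Suc_sym) (simp add: gram_sym)
  have d: "gram n n = 1 + x * y" by (simp add: gram_diag x_def y_def)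
  have IH: "25 * (\<Sum>i<n. \<Sum>j<n. (gram i j)\<^sup>2) = F ((-1) ^ n) x y (real n)"
    using Suc by (simp add: F_def x_def y_def)
  have "25 * (\<Sum>i<Suc n. \<Sum>j<Suc n. (gram i j)\<^sup>2) = F (- ((-1) ^ n)) y (x + y) (real n + 1)"
  proof (cases "even n")
    case True
    then obtain m where m: "n = 2 * m" by auto
    have c: "y\<^sup>2 = x * y + x\<^sup>2 + 1"
      using fib_Cassini_real[of n] True by (simp add: x_def y_def)
    have S: "5 * (\<Sum>i<n. (gram i n)\<^sup>2) = (x\<^sup>2 + y\<^sup>2) * (x * (2 * y - x) + real n)"
      using sum_gram_column_pairs[of m n] sum_odd_fib_squares[of m]
      by (simp add: x_def y_def m)
    from True have s: "(-1) ^ n = (1::real)" by simp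
    \<comment> \<open>The second factor on the right is the quotient of the left side by Cassini's polynomial.\<close>
    have "F (- 1) y (x + y) (real n + 1) - F 1 x y (real n)
       - 10 * ((x\<^sup>2 + y\<^sup>2) * (x * (2 * y - x) + real n)) - 25 * (1 + x * y)\<^sup>2
        = (y\<^sup>2 - x * y - x\<^sup>2 - 1) * (25 * y\<^sup>2 + 5 * x * y + 15 * x\<^sup>2 + 25)"
      by (simp add: F_def field_simps power2_eq_square power4_eq_xxxx)
    also have "\<dots> = 0" using c by simp
    finally show ?thesis unfolding t d using IH S unfolding s by simp
  next
    case False
    then obtain m where m: "n = 2 * m + 1" by (auto elim: oddE)
    have c: "y\<^sup>2 = x * y + x\<^sup>2 - 1"
      using fib_Cassini_real[of n] False by (simp add: x_def y_def)
    \<comment> \<open>The last row \<open>2 m\<close> is left over from the pairing and sits just above the diagonal.\<close>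
    have "gram (2 * m) n = x * x"
      using m by (subst gram_above_diag) (auto simp: x_def)
    moreover have p: "real (fib (2 * m)) = y - x" "real (fib (2 * m + 1)) = x"
      by (simp_all add: x_def y_def m)
    moreover define r where "r = (\<Sum>k<m. (real (fib (2 * k + 1)))\<^sup>2)"
    ultimately have "(\<Sum>i<n. (gram i n)\<^sup>2) = (x\<^sup>2 + y\<^sup>2) * r + (x * x)\<^sup>2"
      using sum_gram_column_pairs[of m n] by (simp add: m x_def y_def)
    then have "5 * (\<Sum>i<n. (gram i n)\<^sup>2) = (x\<^sup>2 + y\<^sup>2) * (5 * r) + 5 * x ^ 4"
      by (simp add: algebra_simps flip: power2_eq_square power_mult_distrib power_mult)
    moreover have "5 * r = (y - x) * (3 * x - y) + (real n - 1)"
      using sum_odd_fib_squares[of m] unfolding r_def p by (simp add: m algebra_simps)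
    ultimately have S: "5 * (\<Sum>i<n. (gram i n)\<^sup>2) =
        (x\<^sup>2 + y\<^sup>2) * ((y - x) * (3 * x - y) + (real n - 1)) + 5 * x ^ 4"
      by simp
    from False have s: "(-1) ^ n = (-1::real)" by simp
    have "F 1 y (x + y) (real n + 1) - F (- 1) x y (real n)
       - 10 * (((x\<^sup>2 + y\<^sup>2) * ((y - x) * (3 * x - y) + (real n - 1)) + 5 * x ^ 4)) - 25 * (1 + x * y)\<^sup>2
        = (y\<^sup>2 - x * y - x\<^sup>2 + 1) * (35 * y\<^sup>2 - 5 * x * y + 45 * x\<^sup>2 + 25)"
      by (simp add: F_def field_simps power2_eq_square power4_eq_xxxx)
    also have "\<dots> = 0" using c by simp
    finally show ?thesis unfolding t d using IH S unfolding s by simp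
  qed
  then show ?case unfolding F_def z y_def[symmetric] by (simp add: algebra_simps)
qed simp

section \<open>Entries of the inverses\<close>

text \<open>
  Let \<open>P\<close> and \<open>N\<close> be the sums of the positive and of the negative parts so far.  Since the
  coefficients lie in \<open>[0, 1]\<close>, the next term lies between \<open>-P\<close> and \<open>N\<close>; it enlarges only one of
  \<open>P\<close> and \<open>N\<close>, by at most the other one.  So neither of them exceeds the old \<open>P + N\<close>, and
  \<open>P + N\<close> grows by at most \<open>max P N\<close>, which is the Fibonacci recursion.
\<close>
lemma forward_substitution_fib_bound:
  fixes a :: "nat \<Rightarrow> real" and x :: "nat \<Rightarrow> nat \<Rightarrow> real"
  assumes a0: "a 0 = 1"
    and rec: "\<And>i. Suc i < n \<Longrightarrow> a (Suc i) = - (\<Sum>j\<le>i. x i j * a j)"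
    and x: "\<And>i j. Suc i < n \<Longrightarrow> j \<le> i \<Longrightarrow> 0 \<le> x i j \<and> x i j \<le> 1"
    and "i < n"
  shows "\<bar>a i\<bar> \<le> fib_coeff i"
proof -
  define P where "P i = (\<Sum>j\<le>i. max (a j) 0)" for i
  define N where "N i = (\<Sum>j\<le>i. max (- a j) 0)" for i
  have step: "- P i \<le> a (Suc i) \<and> a (Suc i) \<le> N i" if "Suc i < n" for i
  proof -
    have "- max (- t) 0 \<le> s * t \<and> s * t \<le> max t 0" if "0 \<le> s" "s \<le> 1" for s t :: real
    proof (cases "t \<ge> 0")
      case True
      then show ?thesis using that mult_left_le_one_le[of t s] by (simp add: max_def)
    next
      case False
      then show ?thesis using that mult_left_le_one_le[of "- t" s]
        by (simp add: max_def mult_nonneg_nonpos)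
    qed
    then have term_bounds: "x i j * a j \<le> max (a j) 0 \<and> - (x i j * a j) \<le> max (- a j) 0"
      if "j \<le> i" for j
      using x[OF \<open>Suc i < n\<close> that] by (metis minus_le_iff)
    have "(\<Sum>j\<le>i. x i j * a j) \<le> P i" "(\<Sum>j\<le>i. - (x i j * a j)) \<le> N i"
      unfolding P_def N_def using term_bounds by (auto intro: sum_mono)
    with rec[OF that] show ?thesis by (simp add: sum_negf)
  qed
  have bound: "P i \<le> fib (Suc i) \<and> N i \<le> fib (Suc i) \<and> P i + N i \<le> fib (Suc (Suc i))"
    if "i < n" for i
    using that
  proof (induction i)
    case (Suc i)
    have "P (Suc i) = P i + max (a (Suc i)) 0" "N (Suc i) = N i + max (- a (Suc i)) 0"
      by (simp_all add: P_def N_def)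
    with Suc step[OF Suc.prems] show ?case by (auto simp: max_def)
  qed (simp add: P_def N_def a0)
  show ?thesis
  proof (cases i)
    case (Suc k)
    with step[of k] bound[of k] \<open>i < n\<close>
    have "- real (fib i) \<le> a i" "a i \<le> real (fib i)" by auto
    with Suc show ?thesis by (simp add: fib_coeff_def)
  qed (simp add: a0 fib_coeff_def)
qed

lemma K_properties:
  assumes "X \<in> K n"
  shows "X \<in> carrier_mat n n"
    and "\<And>i j. i < n \<Longrightarrow> j < n \<Longrightarrow> X $$ (i, j) \<in> {0, 1}"
    and "\<And>i j. i < j \<Longrightarrow> j < n \<Longrightarrow> X $$ (i, j) = 0"
    and "\<And>i. i < n \<Longrightarrow> X $$ (i, i) = 1"
    and "\<exists>Y \<in> carrier_mat n n. X * Y = 1\<^sub>m n"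
proof -
  show X: "X \<in> carrier_mat n n"
    and el: "\<And>i j. i < n \<Longrightarrow> j < n \<Longrightarrow> X $$ (i, j) \<in> {0, 1}"
    and lt: "\<And>i j. i < j \<Longrightarrow> j < n \<Longrightarrow> X $$ (i, j) = 0"
    using assms by (auto simp: K_def lower_triangular_def)
  obtain Y where XY: "X * Y = 1\<^sub>m n" and YX: "Y * X = 1\<^sub>m (dim_row Y)"
    using assms X by (auto simp: K_def invertible_mat_def inverts_mat_def)
  have "dim_col Y = n" using arg_cong[OF XY, of dim_col] by simp
  moreover have "dim_row Y = n" using arg_cong[OF YX, of dim_col] X by simp
  ultimately have Y: "Y \<in> carrier_mat n n" by auto
  with XY YX show "\<exists>Y \<in> carrier_mat n n. X * Y = 1\<^sub>m n" by auto
  have "det X * det Y = 1"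
    using det_mult[OF X Y] XY by simp
  then have "det X \<noteq> 0" by auto
  then have nz: "prod_list (diag_mat X) \<noteq> 0"
    using det_lower_triangular[OF lt X] by simp
  show "X $$ (i, i) = 1" if "i < n" for i
  proof -
    have "X $$ (i, i) \<in> set (diag_mat X)"
      using that X by (auto simp: diag_mat_def)
    with nz have "X $$ (i, i) \<noteq> 0" by (metis prod_list_zero_iff)
    with el[OF that that] show ?thesis by simp
  qed
qed

text \<open>
  Column \<open>k\<close> of the inverse is obtained by forward substitution from the unit vector \<open>e\<^sub>k\<close>: it
  vanishes above row \<open>k\<close>, equals 1 there, and continues by the recurrence just bounded.
\<close>
lemma inverse_entry_bound:
  assumes "X \<in> K n" and Y: "Y \<in> carrier_mat n n" and XY: "X * Y = 1\<^sub>m n"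
    and "i < n" and k: "k < n"
  shows "\<bar>Y $$ (i, k)\<bar> \<le> (if k \<le> i then fib_coeff (i - k) else 0)"
proof -
  note X = K_properties[OF \<open>X \<in> K n\<close>]
  have row: "Y $$ (i, k) = (if i = k then 1 else 0) - (\<Sum>j<i. X $$ (i, j) * Y $$ (j, k))"
    if "i < n" for i
  proof -
    have "(if i = k then 1 else 0) = (X * Y) $$ (i, k)"
      using that k by (simp add: XY)
    also have "\<dots> = (\<Sum>j<n. X $$ (i, j) * Y $$ (j, k))"
      using that k X(1) Y by (simp add: scalar_prod_def atLeast0LessThan)
    also have "\<dots> = (\<Sum>j<Suc i. X $$ (i, j) * Y $$ (j, k))"
      using that X(3) by (intro sum.mono_neutral_right) auto
    finally show ?thesis using X(4)[OF that] by simp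
  qed
  have zero: "Y $$ (i, k) = 0" if "i < k" for i
    using that
  proof (induction i rule: less_induct)
    case (less i)
    with row[of i] k show ?case by simp
  qed
  define a where "a m = Y $$ (k + m, k)" for m
  have "\<bar>a m\<bar> \<le> fib_coeff m" if "m < n - k" for m
  proof (rule forward_substitution_fib_bound[where n = "n - k" and x = "\<lambda>m j. X $$ (k + Suc m, k + j)"])
    show "a 0 = 1" using row[OF k] zero by (simp add: a_def)
    show "a (Suc m) = - (\<Sum>j\<le>m. X $$ (k + Suc m, k + j) * a j)" if "Suc m < n - k" for m
    proof -
      have "(\<Sum>j<k + Suc m. X $$ (k + Suc m, j) * Y $$ (j, k)) =
            (\<Sum>j\<in>{k..<k + Suc m}. X $$ (k + Suc m, j) * Y $$ (j, k))"
        using zero by (intro sum.mono_neutral_right) auto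
      also have "\<dots> = (\<Sum>j\<le>m. X $$ (k + Suc m, k + j) * a j)"
        unfolding a_def
        by (rule sum.reindex_bij_witness[of _ "\<lambda>j. k + j" "\<lambda>j. j - k"]) auto
      finally show ?thesis using row[of "k + Suc m"] that by (simp add: a_def)
    qed
    show "0 \<le> X $$ (k + Suc m, k + j) \<and> X $$ (k + Suc m, k + j) \<le> 1"
      if "Suc m < n - k" "j \<le> m" for m j
    proof -
      have "k + Suc m < n" "k + j < n" using that by simp_all
      with X(2) have "X $$ (k + Suc m, k + j) \<in> {0, 1}" by blast
      then show ?thesis by auto
    qed
  qed (use that in simp)
  from this[of "i - k"] zero[of i] \<open>i < n\<close> show ?thesis
    by (auto simp: a_def)
qed

section \<open>Bounding a quadratic form by trace and Frobenius norm\<close>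

text \<open>
  Subtracting \<open>T/n\<close> and \<open>U/n\<close> from the diagonals of \<open>g\<close> and of \<open>u u\<^sup>T\<close>, where \<open>U = |u|\<^sup>2\<close>, makes
  both matrices traceless.  The squares of their Frobenius norms drop to \<open>Q - T\<^sup>2/n\<close> and
  \<open>U\<^sup>2 (1 - 1/n)\<close>, and their Frobenius inner product is the form minus \<open>T U/n\<close>; the bound is
  Cauchy--Schwarz for this pair.
\<close>
lemma quadratic_form_le_trace_frobenius:
  fixes g :: "nat \<Rightarrow> nat \<Rightarrow> real" and u :: "nat \<Rightarrow> real"
  assumes "n > 0"
  defines "T \<equiv> \<Sum>i<n. g i i" and "Q \<equiv> \<Sum>i<n. \<Sum>j<n. (g i j)\<^sup>2"
  shows "(\<Sum>i<n. \<Sum>j<n. g i j * u i * u j) \<le>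
    (T / n + sqrt ((1 - 1 / n) * (Q - T\<^sup>2 / n))) * (\<Sum>i<n. (u i)\<^sup>2)"
proof -
  define U where "U = (\<Sum>i<n. (u i)\<^sup>2)"
  define A where "A = (\<Sum>i<n. \<Sum>j<n. g i j * u i * u j)"
  define f where "f i j = g i j - (if i = j then T / n else 0)" for i j
  define h where "h i j = u i * u j - (if i = j then U / n else 0)" for i j
  have split: "(\<Sum>i<n. \<Sum>j<n. p i j + (if i = j then q i else 0)) =
      (\<Sum>i<n. \<Sum>j<n. p i j) + (\<Sum>i<n. q i)" for p :: "nat \<Rightarrow> nat \<Rightarrow> real" and q
    by (simp add: sum.distrib sum.delta)
  have fh: "(\<Sum>i<n. \<Sum>j<n. f i j * h i j) = A - T / n * U"
  proof -
    have "f i j * h i j = g i j * u i * u j + (if i = j then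
         T * U / n\<^sup>2 - T / n * (u i)\<^sup>2 - U / n * g i i else 0)" for i j
      by (simp add: f_def h_def power2_eq_square algebra_simps)
    then have "(\<Sum>i<n. \<Sum>j<n. f i j * h i j) = A + 
        (\<Sum>i<n. T * U / n\<^sup>2 - T / n * (u i)\<^sup>2 - U / n * g i i)"
      by (simp only: split A_def)
    also have "(\<Sum>i<n. T * U / n\<^sup>2 - T / n * (u i)\<^sup>2 - U / n * g i i) =
        n * (T * U / n\<^sup>2) - T / n * U - U / n * T"
      by (simp add: sum_subtractf U_def T_def sum_distrib_left)
    finally show ?thesis using \<open>n > 0\<close> by (simp add: field_simps power2_eq_square)
  qed
  have ff: "(\<Sum>i<n. \<Sum>j<n. (f i j)\<^sup>2) = Q - T\<^sup>2 / n"
  proof -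
    have "(f i j)\<^sup>2 = (g i j)\<^sup>2 + (if i = j then T\<^sup>2 / n\<^sup>2 - 2 * T / n * g i i else 0)" for i j
      by (simp add: f_def power2_eq_square algebra_simps)
    then have "(\<Sum>i<n. \<Sum>j<n. (f i j)\<^sup>2) = Q + (\<Sum>i<n. T\<^sup>2 / n\<^sup>2 - 2 * T / n * g i i)"
      by (simp only: split Q_def)
    also have "(\<Sum>i<n. T\<^sup>2 / n\<^sup>2 - 2 * T / n * g i i) = n * (T\<^sup>2 / n\<^sup>2) - 2 * T / n * T"
      by (simp add: sum_subtractf T_def sum_distrib_left)
    finally show ?thesis using \<open>n > 0\<close> by (simp add: field_simps power2_eq_square)
  qed
  have hh: "(\<Sum>i<n. \<Sum>j<n. (h i j)\<^sup>2) = U\<^sup>2 * (1 - 1 / n)"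
  proof -
    have "(h i j)\<^sup>2 = (u i)\<^sup>2 * (u j)\<^sup>2 + (if i = j then U\<^sup>2 / n\<^sup>2 - 2 * U / n * (u i)\<^sup>2 else 0)" for i j
      by (simp add: h_def power2_eq_square algebra_simps)
    then have "(\<Sum>i<n. \<Sum>j<n. (h i j)\<^sup>2) = (\<Sum>i<n. \<Sum>j<n. (u i)\<^sup>2 * (u j)\<^sup>2) +
        (\<Sum>i<n. U\<^sup>2 / n\<^sup>2 - 2 * U / n * (u i)\<^sup>2)"
      by (simp only: split)
    also have "(\<Sum>i<n. \<Sum>j<n. (u i)\<^sup>2 * (u j)\<^sup>2) = U\<^sup>2"
      by (simp add: U_def power2_eq_square sum_product)
    also have "(\<Sum>i<n. U\<^sup>2 / n\<^sup>2 - 2 * U / n * (u i)\<^sup>2) = n * (U\<^sup>2 / n\<^sup>2) - 2 * U / n * U"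
      by (simp add: sum_subtractf U_def sum_distrib_left)
    finally show ?thesis using \<open>n > 0\<close> by (simp add: field_simps power2_eq_square)
  qed
  have pairs: "(\<Sum>z\<in>{..<n} \<times> {..<n}. case_prod f z * case_prod h z) = (\<Sum>i<n. \<Sum>j<n. f i j * h i j)"
    "(\<Sum>z\<in>{..<n} \<times> {..<n}. (case_prod p z)\<^sup>2) = (\<Sum>i<n. \<Sum>j<n. (p i j)\<^sup>2)"
    for p :: "nat \<Rightarrow> nat \<Rightarrow> real"
    by (simp_all add: sum.cartesian_product case_prod_unfold)
  have "(\<Sum>z\<in>{..<n} \<times> {..<n}. case_prod f z * case_prod h z)\<^sup>2 \<le>
      (\<Sum>z\<in>{..<n} \<times> {..<n}. (case_prod f z)\<^sup>2) * (\<Sum>z\<in>{..<n} \<times> {..<n}. (case_prod h z)\<^sup>2)"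
    by (rule Cauchy_Schwarz_ineq_sum)
  then have "(A - T / n * U)\<^sup>2 \<le> (Q - T\<^sup>2 / n) * (U\<^sup>2 * (1 - 1 / n))"
    by (simp only: pairs fh ff hh power2_eq_square[symmetric])
  then have "A - T / n * U \<le> sqrt (((1 - 1 / n) * (Q - T\<^sup>2 / n)) * U\<^sup>2)"
    by (intro real_le_rsqrt) (simp add: mult_ac)
  also have "\<dots> = sqrt ((1 - 1 / n) * (Q - T\<^sup>2 / n)) * U"
    by (simp add: real_sqrt_mult U_def sum_nonneg)
  finally show ?thesis by (simp add: A_def U_def algebra_simps)
qed

section \<open>From the quadratic form to the eigenvalues\<close>

lemma sum_squares_eq_gram:
  "(\<Sum>k<n. (\<Sum>i\<in>{k..<n}. fib_coeff (i - k) * u i)\<^sup>2) = (\<Sum>i<n. \<Sum>j<n. gram i j * u i * u j)"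
proof -
  define b where "b i k = (if k \<le> i then fib_coeff (i - k) else 0)" for i k
  have "(\<Sum>i\<in>{k..<n}. fib_coeff (i - k) * u i) = (\<Sum>i<n. b i k * u i)" for k
    by (rule sum.mono_neutral_cong_left) (auto simp: b_def)
  then have "(\<Sum>k<n. (\<Sum>i\<in>{k..<n}. fib_coeff (i - k) * u i)\<^sup>2) =
      (\<Sum>k<n. \<Sum>i<n. \<Sum>j<n. b i k * u i * (b j k * u j))"
    by (simp add: power2_eq_square sum_product)
  also have "\<dots> = (\<Sum>i<n. \<Sum>j<n. \<Sum>k<n. b i k * u i * (b j k * u j))"
    by (subst sum.swap) (intro sum.cong refl sum.swap)
  also have "\<dots> = (\<Sum>i<n. \<Sum>j<n. gram i j * u i * u j)"
  proof (intro sum.cong refl)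
    fix i j assume "i \<in> {..<n}" "j \<in> {..<n}"
    then have "(\<Sum>k<n. b i k * b j k) = gram i j"
      unfolding gram_def by (intro sum.mono_neutral_cong_right) (auto simp: b_def)
    then show "(\<Sum>k<n. b i k * u i * (b j k * u j)) = gram i j * u i * u j"
      by (simp add: sum_distrib_right mult_ac flip: sum_distrib_left)
  qed
  finally show ?thesis .
qed

text \<open>
  Put \<open>w = X\<^sup>T v\<close> for an eigenvector \<open>v\<close>.  Then \<open>w \<bullet> w = l (v \<bullet> v)\<close>, and recovering \<open>v\<close> from \<open>w\<close>
  through the inverse gives \<open>v \<bullet> v \<le> D (w \<bullet> w)\<close>; together \<open>1 \<le> D l\<close>.
\<close>
lemma eigenvalue_ge_if_gram_form_le:
  assumes XK: "X \<in> K n" and ev: "eigenvalue (X * transpose_mat X) l"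
    and D: "\<And>u. (\<Sum>i<n. \<Sum>j<n. gram i j * u i * u j) \<le> D * (\<Sum>i<n. (u i)\<^sup>2)"
  shows "1 / D \<le> l"
proof -
  note X = K_properties[OF XK]
  obtain Y where Y: "Y \<in> carrier_mat n n" and XY: "X * Y = 1\<^sub>m n"
    using X(5) by blast
  obtain v where v: "v \<in> carrier_vec n" "v \<noteq> 0\<^sub>v n"
    and eig: "(X * transpose_mat X) *\<^sub>v v = l \<cdot>\<^sub>v v"
    using ev X(1) by (auto simp: eigenvalue_def eigenvector_def)
  define w where "w = transpose_mat X *\<^sub>v v"
  have w: "w \<in> carrier_vec n" using X(1) v by (simp add: w_def)
  have "transpose_mat Y *\<^sub>v w = (transpose_mat Y * transpose_mat X) *\<^sub>v v"
    using X(1) Y v by (simp add: w_def assoc_mult_mat_vec[of _ n n _ n])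
  also have "transpose_mat Y * transpose_mat X = 1\<^sub>m n"
    using transpose_mult[OF X(1) Y] XY by simp
  finally have vw: "transpose_mat Y *\<^sub>v w = v" using v by simp
  have "w \<bullet> w = v \<bullet> (X *\<^sub>v w)"
    using transpose_vec_mult_scalar[OF X(1) w v(1)] by (simp add: w_def)
  also have "X *\<^sub>v w = l \<cdot>\<^sub>v v"
    using eig X(1) v by (simp add: w_def assoc_mult_mat_vec[of _ n n _ n])
  also have "v \<bullet> (l \<cdot>\<^sub>v v) = l * (v \<bullet> v)" using v by simp
  finally have wl: "w \<bullet> w = l * (v \<bullet> v)" .
  have sq: "z \<bullet> z = (\<Sum>i<n. (z $ i)\<^sup>2)" if "z \<in> carrier_vec n" for z :: "real vec"
    using that by (simp add: scalar_prod_def power2_eq_square atLeast0LessThan)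
  have "\<bar>v $ k\<bar> \<le> (\<Sum>i\<in>{k..<n}. fib_coeff (i - k) * \<bar>w $ i\<bar>)" if k: "k < n" for k
  proof -
    have "v $ k = (\<Sum>i<n. Y $$ (i, k) * w $ i)"
      using k Y w by (subst vw[symmetric]) (simp add: scalar_prod_def atLeast0LessThan)
    also have "\<bar>\<dots>\<bar> \<le> (\<Sum>i<n. \<bar>Y $$ (i, k)\<bar> * \<bar>w $ i\<bar>)"
      by (rule order_trans[OF sum_abs]) (simp add: abs_mult)
    also have "\<dots> \<le> (\<Sum>i<n. (if k \<le> i then fib_coeff (i - k) else 0) * \<bar>w $ i\<bar>)"
      using inverse_entry_bound[OF XK Y XY _ k] by (intro sum_mono mult_right_mono) auto
    also have "\<dots> = (\<Sum>i\<in>{k..<n}. fib_coeff (i - k) * \<bar>w $ i\<bar>)"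
      by (rule sum.mono_neutral_cong_right) auto
    finally show ?thesis .
  qed
  moreover have "t\<^sup>2 \<le> r\<^sup>2" if "\<bar>t\<bar> \<le> r" for t r :: real
    using power_mono[OF that, of 2] by simp
  ultimately have "v \<bullet> v \<le> (\<Sum>k<n. (\<Sum>i\<in>{k..<n}. fib_coeff (i - k) * \<bar>w $ i\<bar>)\<^sup>2)"
    unfolding sq[OF v(1)] by (intro sum_mono) auto
  also have "\<dots> \<le> D * (w \<bullet> w)"
    unfolding sum_squares_eq_gram sq[OF w] using D[of "\<lambda>i. \<bar>w $ i\<bar>"] by simp
  finally have le: "v \<bullet> v \<le> D * (w \<bullet> w)" .
  obtain i where "i < n" "v $ i \<noteq> 0"
    using v by (metis carrier_vecD eq_vecI index_zero_vec)
  then have vpos: "v \<bullet> v > 0"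
    unfolding sq[OF v(1)] by (intro sum_pos2[of _ i]) auto
  have "0 \<le> l * (v \<bullet> v)"
    unfolding wl[symmetric] sq[OF w] by (simp add: sum_nonneg)
  with vpos have "l \<ge> 0" by (simp add: zero_le_mult_iff)
  have Dl: "1 \<le> D * l"
    using le vpos unfolding wl by (simp flip: mult.assoc)
  with \<open>l \<ge> 0\<close> have "l > 0" by (cases "l = 0") auto
  have "D > 0"
  proof (rule ccontr)
    assume "\<not> D > 0"
    with \<open>l > 0\<close> have "D * l \<le> 0" by (simp add: mult_nonpos_nonneg)
    with Dl show False by simp
  qed
  with Dl show ?thesis by (simp add: divide_le_eq mult.commute)
qed

text \<open>
  The minimum defining \<open>c n\<close> is attained: there are finitely many 0-1 matrices of size \<open>n\<close>, each
  product has finitely many eigenvalues, and the identity matrix contributes the eigenvalue 1.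
\<close>
lemma c_ge_if_eigenvalues_ge:
  assumes n: "n > 0" and "\<And>X l. X \<in> K n \<Longrightarrow> eigenvalue (X * transpose_mat X) l \<Longrightarrow> d \<le> l"
  shows "d \<le> c n"
proof -
  have "K n \<subseteq> (\<lambda>S. mat n n (\<lambda>z. if z \<in> S then 1 else 0)) ` Pow ({..<n} \<times> {..<n})"
  proof
    fix X assume XK: "X \<in> K n"
    note X = K_properties[OF XK]
    have "X = mat n n (\<lambda>z. if z \<in> {z \<in> {..<n} \<times> {..<n}. X $$ z = 1} then 1 else 0)"
      using X(1,2) by (intro eq_matI) auto
    then show "X \<in> (\<lambda>S. mat n n (\<lambda>z. if z \<in> S then 1 else 0)) ` Pow ({..<n} \<times> {..<n})"
      by blast
  qed
  then have "finite (K n)" by (rule finite_subset) auto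
  moreover have "{l. \<exists>X \<in> K n. eigenvalue (X * transpose_mat X) l} =
      (\<Union>X\<in>K n. spectrum (X * transpose_mat X))"
    by (auto simp: spectrum_def)
  moreover have "finite (spectrum (X * transpose_mat X))" if "X \<in> K n" for X
    using K_properties(1)[OF that] by (intro card_finite_spectrum[of _ n]) auto
  ultimately have fin: "finite {l. \<exists>X \<in> K n. eigenvalue (X * transpose_mat X) l}"
    by simp
  have "\<exists>B. 1\<^sub>m n * B = 1\<^sub>m n \<and> B * 1\<^sub>m n = (1\<^sub>m (dim_row B) :: real mat)"
    by (rule exI[of _ "1\<^sub>m n"]) simp
  then have "1\<^sub>m n \<in> K n"
    by (auto simp: K_def lower_triangular_def invertible_mat_def inverts_mat_def elements_mat_def)
  moreover have "eigenvector (1\<^sub>m n * transpose_mat (1\<^sub>m n)) (unit_vec n 0) (1::real)"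
    using n by (simp add: eigenvector_def)
  then have "eigenvalue (1\<^sub>m n * transpose_mat (1\<^sub>m n)) (1::real)"
    unfolding eigenvalue_def by blast
  ultimately have "{l. \<exists>X \<in> K n. eigenvalue (X * transpose_mat X) l} \<noteq> {}"
    by blast
  with fin show ?thesis unfolding c_def using assms(2) by (subst Min_ge_iff) auto
qed

section \<open>Evaluation in powers of the golden ratio\<close>

text \<open>
  Binet's formula, read backwards.  With \<open>\<psi> = (1 - sqrt 5)/2 = -1/\<phi>\<close>, \<open>p = \<phi>\<^sup>n\<close> and \<open>q = \<psi>\<^sup>n\<close>
  one has \<open>p q = (-1)\<^sup>n\<close>, so the even negative powers of \<open>\<phi>\<close> are even powers of \<open>\<psi>\<close>; moreover
  \<open>2 F\<^sub>n\<^sub>+\<^sub>1 - F\<^sub>n = p + q\<close>.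
\<close>
lemma golden_ratio_powers:
  fixes n :: nat
  defines "x \<equiv> real (fib n)" and "y \<equiv> real (fib (Suc n))"
  shows "\<phi> powi (2 * int n) + \<phi> powi (- 2 * int n) = 5 * x\<^sup>2 + 2 * (-1) ^ n"
    and "sqrt 5 * (\<phi> powi (2 * int n) - \<phi> powi (- 2 * int n)) = 5 * (x * (2 * y - x))"
    and "\<phi> powi (4 * int n) + \<phi> powi (- 4 * int n) = (5 * x\<^sup>2 + 2 * (-1) ^ n)\<^sup>2 - 2"
proof -
  define \<psi> :: real where "\<psi> = (1 - sqrt 5) / 2"
  define p where "p = \<phi> ^ n"
  define q where "q = \<psi> ^ n"
  have pos: "\<phi> > 0" by (simp add: \<phi>_def add_pos_nonneg)
  have prod: "\<phi> * \<psi> = - 1" by (simp add: \<phi>_def \<psi>_def field_simps)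
  have pq: "p * q = (-1) ^ n" by (simp add: p_def q_def prod flip: power_mult_distrib)
  then have pq2: "p\<^sup>2 * q\<^sup>2 = 1" by (simp flip: power_mult_distrib power_mult)
  have "p > 0" using pos by (simp add: p_def)
  have "\<phi> powi int (2 * n) = p\<^sup>2" "\<phi> powi int (4 * n) = (p\<^sup>2)\<^sup>2"
    unfolding power_int_of_nat p_def by (simp_all add: mult.commute flip: power_mult)
  then have e: "\<phi> powi (2 * int n) = p\<^sup>2" "\<phi> powi (4 * int n) = (p\<^sup>2)\<^sup>2"
    by simp_all
  have "inverse (p\<^sup>2) = q\<^sup>2" using pq2 \<open>p > 0\<close> by (simp add: field_simps)
  then have e': "\<phi> powi (- 2 * int n) = q\<^sup>2" "\<phi> powi (- 4 * int n) = (q\<^sup>2)\<^sup>2"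
    unfolding minus_mult_left[symmetric] power_int_minus e power_inverse[symmetric] by simp_all
  have x: "x = (p - q) / sqrt 5"
    unfolding x_def p_def q_def \<phi>_def \<psi>_def by (rule fib_closed_form)
  have y: "y = (p * \<phi> - q * \<psi>) / sqrt 5"
    unfolding y_def p_def q_def \<phi>_def \<psi>_def
    by (subst fib_closed_form) (simp add: mult.commute)
  have "2 * y - x = p + q"
    unfolding x y by (simp add: \<phi>_def \<psi>_def field_simps)
  with x have xy: "x * (2 * y - x) = (p\<^sup>2 - q\<^sup>2) / sqrt 5"
    by (simp add: algebra_simps power2_eq_square)
  have L: "p\<^sup>2 + q\<^sup>2 = 5 * x\<^sup>2 + 2 * (-1) ^ n"
    unfolding x pq[symmetric] by (simp add: power_divide power2_diff add_divide_distrib diff_divide_distrib)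
  show "\<phi> powi (2 * int n) + \<phi> powi (- 2 * int n) = 5 * x\<^sup>2 + 2 * (-1) ^ n"
    unfolding e e' L ..
  show "sqrt 5 * (\<phi> powi (2 * int n) - \<phi> powi (- 2 * int n)) = 5 * (x * (2 * y - x))"
  proof -
    have "5 * (x * (2 * y - x)) = (5 / sqrt 5) * (p\<^sup>2 - q\<^sup>2)"
      by (simp add: xy)
    also have "5 / sqrt 5 = sqrt 5" by (rule real_div_sqrt) simp
    finally show ?thesis unfolding e e' by simp
  qed
  show "\<phi> powi (4 * int n) + \<phi> powi (- 4 * int n) = (5 * x\<^sup>2 + 2 * (-1) ^ n)\<^sup>2 - 2"
    unfolding e e' L[symmetric] power2_sum using pq2 by simp
qed

text \<open>
  With \<open>s = (-1)\<^sup>n\<close>, \<open>L = \<phi>\<^sup>2\<^sup>n + \<phi>\<^sup>-\<^sup>2\<^sup>n\<close> and \<open>E = sqrt 5 (\<phi>\<^sup>2\<^sup>n - \<phi>\<^sup>-\<^sup>2\<^sup>n)\<close> the trace, the Frobenius norm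
  and \<open>R n\<close> are all polynomial in \<open>s\<close>, \<open>L\<close> and \<open>E\<close>, and \<open>s\<^sup>2 = 1\<close> is the only relation that their
  comparison needs.
\<close>
lemma trace_frobenius_bound_gram:
  fixes n :: nat
  assumes "n \<ge> 2"
  defines "T \<equiv> \<Sum>i<n. gram i i" and "Q \<equiv> \<Sum>i<n. \<Sum>j<n. (gram i j)\<^sup>2"
  shows "T / n + sqrt ((1 - 1 / n) * (Q - T\<^sup>2 / n)) =
    1 + ((-1) ^ n - 5) / (10 * real n)
      + (\<phi> powi (2 * int n) + \<phi> powi (- 2 * int n)) / (5 * real n)
      + (real n - 1) / (5 * real n) * sqrt (R n)"
proof -
  define s where "s = ((-1) ^ n :: real)"
  define L where "L = \<phi> powi (2 * int n) + \<phi> powi (- 2 * int n)"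
  define E where "E = sqrt 5 * (\<phi> powi (2 * int n) - \<phi> powi (- 2 * int n))"
  have s2: "s * s = 1" by (simp add: s_def flip: power_mult_distrib)
  have n: "real n > 1" using assms(1) by simp
  have T: "T = real n + (s - 5) / 10 + L / 5"
    unfolding T_def trace_gram L_def golden_ratio_powers s_def by (simp add: field_simps)
  have Q: "25 * Q = L\<^sup>2 + (s + 3) * L + (13 * s - 37) / 2 + 25 * real n + 2 * real n * E"
    unfolding Q_def frobenius_norm_gram L_def E_def golden_ratio_powers s_def by simp
  have R4: "\<phi> powi (4 * int n) + \<phi> powi (- 4 * int n) = L\<^sup>2 - 2"
    unfolding L_def golden_ratio_powers ..
  have "R n = 4 * s / (real n - 1) + 2 * (real n)\<^sup>2 * E / (real n - 1) + (3 * s + 17) / 2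
     + (s - 7 - 2 / (real n - 1)) * L + (L\<^sup>2 - 2)"
    using R4 unfolding R_def L_def E_def s_def by (simp add: mult_ac)
  moreover have clear: "d * (p / d + q / d + r + (t - 2 / d) * L + v) =
      p + q + d * r + (d * t - 2) * L + d * v" if "d \<noteq> 0" for d p q r t v :: real
    using that by (simp add: field_simps)
  ultimately have "(real n - 1) * R n = 4 * s + 2 * (real n)\<^sup>2 * E + (real n - 1) * ((3 * s + 17) / 2)
     + ((real n - 1) * (s - 7) - 2) * L + (real n - 1) * (L\<^sup>2 - 2)"
    using clear[of "real n - 1"] n by simp
  also have "\<dots> = real n * (25 * Q) - 25 * T\<^sup>2"
    unfolding Q T using s2 by (simp add: field_simps power2_eq_square)
  finally have R: "(real n - 1) * R n = 25 * (real n * Q - T\<^sup>2)" by simp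
  have "(1 - 1 / n) * (Q - T\<^sup>2 / n) = (real n - 1) * (25 * (real n * Q - T\<^sup>2)) / (5 * real n)\<^sup>2"
    using n by (simp add: field_simps power2_eq_square)
  also have "\<dots> = ((real n - 1) / (5 * real n))\<^sup>2 * R n"
    unfolding R[symmetric] by (simp add: power2_eq_square)
  finally have "sqrt ((1 - 1 / n) * (Q - T\<^sup>2 / n)) = (real n - 1) / (5 * real n) * sqrt (R n)"
    using n by (simp add: real_sqrt_mult)
  moreover have "T / n = 1 + (s - 5) / (10 * real n) + L / (5 * real n)"
    unfolding T using n by (simp add: field_simps)
  ultimately show ?thesis by (simp add: s_def L_def)
qed

theorem theorem4p1:
  fixes n :: nat
  assumes "n \<ge> 2"
  shows "c n \<ge> 1 / (1 + ((-1) ^ n - 5) / (10 * real n)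
                     + (\<phi> powi (2 * int n) + \<phi> powi (- 2 * int n)) / (5 * real n)
                     + (real n - 1) / (5 * real n) * sqrt (R n))"
proof (rule c_ge_if_eigenvalues_ge)
  show n: "n > 0" using assms by simp
  fix X l assume "X \<in> K n" "eigenvalue (X * transpose_mat X) l"
  then show "1 / (1 + ((-1) ^ n - 5) / (10 * real n)
                     + (\<phi> powi (2 * int n) + \<phi> powi (- 2 * int n)) / (5 * real n)
                     + (real n - 1) / (5 * real n) * sqrt (R n)) \<le> l"
    unfolding trace_frobenius_bound_gram[OF assms, symmetric]
    using quadratic_form_le_trace_frobenius[OF n] by (rule eigenvalue_ge_if_gram_form_le)
qed

end
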